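(* Let $f$ be a probability mass function with discrete support $\mathbb{T}\subseteq\mathbb{R}$, let $X_1,X_2,\ldots$ be i.i.d. discrete random variables with probability mass function $f$, let $(h_n)_{n\ge 1}$ be a sequence of positive numbers with $\lim_{n\to\infty}h_n=0$, and let $\{K_{x,h}:x\in\mathbb{T},h>0\}$ be a family of kernels, where $K_{x,h}$ is the probability mass function of a discrete random variable $Z_{x,h}$ on a discrete set $\mathbb{S}_x\subseteq\mathbb{R}$. Assume that $$x\in\mathbb{S}_x\ \text{ for every } x\in\mathbb{T},\qquad \lim_{n\to\infty}\sup_{x\in\mathbb{T}}\left|\mathbb{E}(Z_{x,h_n})-x\right|=0,\qquad \lim_{n\to\infty}\sup_{x\in\mathbb{T}}\mathrm{Var}(Z_{x,h_n})=0.$$ Then the normalizing random variable $$C_n=\sum_{x\in\mathbb{T}}\frac1n\sum_{i=1}^nK_{x,h_n}(X_i)$$ converges in mean square to $1$, i.e. $\mathbb{E}\left[|C_n-1|^2\right]\to 0$ as $n\to\infty$.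
   Context: The support $\mathbb{T}$ may be bounded or unbounded, finite or infinite. Each $K_{x,h}$ is a probability mass function on $\mathbb{S}_x$, with $K_{x,h}(z)=0$ for $z\notin\mathbb{S}_x$. It is a standing assumption that $C_n>0$.
   Formalization: The support T is assumed uniformly discrete (its points keep a positive minimal distance, as in ℕ, ℤ or any finite set); for merely discrete T, e.g. T = {√k : k ≥ 1}, the statement is false. *)

theory Defs
  imports "HOL-Probability.Probability"
begin

text \<open>
  The support \<open>T\<close> is taken to be uniformly discrete (\<^const>\<open>uniform_discrete\<close>: its points keep a
  positive minimal distance, as in the integers, the naturals, any lattice or any finite set).
  For a support that is merely topologically discrete (even closed) convergence fails.
  Example: \<open>T = {sqrt k | k \<ge> 1}\<close>, \<open>S x = T\<close> and, for \<open>0 < h < 1\<close>,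
  let \<open>K x h\<close> give mass \<open>h / (x - 1)^2\<close> to \<open>1\<close> and the remaining mass to \<open>x\<close> if \<open>x = sqrt k\<close> with
  \<open>4 \<le> k \<le> N h\<close>, and let it be the point mass at \<open>x\<close> otherwise, with \<open>N h\<close> so large that
  \<open>(\<Sum>k=4..N h. h / (sqrt k - 1)^2) \<ge> 1\<close>. Biases and variances are at most \<open>h\<close>, the normalizing
  variable is positive and finite, but its mean is at least \<open>1 + pmf f 1 - h\<close>.
  The sets \<open>S x\<close> only have to be topologically discrete (\<^const>\<open>topological_space_class.discrete\<close>).
\<close>

text \<open>
  The variance with values in \<open>[0, \<infinity>]\<close>: unlike the Bochner integral, which is \<open>0\<close> for a
  non-integrable function, it is \<open>\<infinity>\<close> if the distribution is not square-integrable.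
\<close>

definition pmf_var :: "real pmf \<Rightarrow> ennreal" where
  "pmf_var p = (\<integral>\<^sup>+ z. ennreal ((z - measure_pmf.expectation p (\<lambda>z. z))\<^sup>2) \<partial>measure_pmf p)"

lemma pmf_var_eq_variance:
  assumes "integrable (measure_pmf p) (\<lambda>z. z\<^sup>2)"
  shows "pmf_var p = ennreal (measure_pmf.variance p (\<lambda>z. z))"
proof -
  have "integrable (measure_pmf p) (\<lambda>z. z)"
    by (rule measure_pmf.square_integrable_imp_integrable) (use assms in auto)
  then have "integrable (measure_pmf p) (\<lambda>z. (z - measure_pmf.expectation p (\<lambda>z. z))\<^sup>2)"
    using assms by (simp add: power2_diff)
  then show ?thesis
    unfolding pmf_var_def by (intro nn_integral_eq_integral) auto
qed

text \<open>
  The normalizing variable \<open>C\<^sub>n\<close>. The outer sum has value \<open>0\<close> where the series diverges, so a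
  positive value includes convergence.
\<close>

definition normalizer ::
  "real set \<Rightarrow> (real \<Rightarrow> real \<Rightarrow> real pmf) \<Rightarrow> (nat \<Rightarrow> real) \<Rightarrow> (nat \<Rightarrow> 'a \<Rightarrow> real) \<Rightarrow> nat \<Rightarrow> 'a \<Rightarrow> real"
  where "normalizer T K h X n \<omega> =
    (\<Sum>\<^sub>\<infinity>x\<in>T. 1 / real n * (\<Sum>i=1..n. pmf (K x (h n)) (X i \<omega>)))"

end

theory Submission
  imports Defs
begin

text \<open>
  Put \<open>G n y = (\<Sum>x\<in>T. K x (h n) y)\<close>, so that \<open>C\<^sub>n - 1\<close> is the average of the \<open>G n (X\<^sub>i) - 1\<close>, \<open>i \<le> n\<close>.
  By Jensen's inequality its second moment is at most that of \<open>G n (X\<^sub>1) - 1\<close>. Chebyshev's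
  inequality bounds \<open>K x (h n) y\<close> for \<open>x \<noteq> y\<close> by \<open>4 v\<^sub>n / (x - y)\<^sup>2\<close>, where \<open>v\<^sub>n\<close> is the supremum
  of the variances, and as \<open>T\<close> is uniformly discrete the sum over \<open>x\<close> is \<open>O(v\<^sub>n)\<close> uniformly in \<open>y\<close>.
  The diagonal term \<open>1 - K y (h n) y\<close> need not be uniformly small, but it tends to \<open>0\<close> for each \<open>y\<close>,
  since \<open>y\<close> is isolated in \<open>S y\<close>, and is dominated by \<open>1\<close>.
\<close>

section \<open>Tail bounds and sums of inverse squares over separated points\<close>

text \<open>Deviations are measured from the target \<open>x\<close> instead of the mean. A point at
  distance at least \<open>d\<close> from \<open>x\<close> is still at distance at least
  \<open>d / 2\<close> from the mean, because the bias uses up at most \<open>d / 2\<close>;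
  squaring the remaining half gives the factor 4.\<close>

lemma pmf_chebyshev:
  fixes p :: "real pmf"
  assumes var: "pmf_var p \<le> ennreal v" and "v \<ge> 0" and "d > 0"
    and bias: "\<bar>measure_pmf.expectation p (\<lambda>z. z) - x\<bar> \<le> d / 2"
  shows "measure_pmf.prob p {z. d \<le> \<bar>z - x\<bar>} \<le> 4 * v / d\<^sup>2"
proof -
  let ?\<mu> = "measure_pmf.expectation p (\<lambda>z. z)"
  let ?A = "{z. d \<le> \<bar>z - x\<bar>}"
  have sq: "(d / 2)\<^sup>2 \<le> (z - ?\<mu>)\<^sup>2" if "d \<le> \<bar>z - x\<bar>" for z
  proof -
    have "d / 2 \<le> \<bar>z - ?\<mu>\<bar>" using that bias by linarith
    then show ?thesis using \<open>d > 0\<close> by (metis abs_le_square_iff abs_of_pos half_gt_zero)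
  qed
  have "ennreal ((d / 2)\<^sup>2 * measure_pmf.prob p ?A) = (\<integral>\<^sup>+z. ennreal ((d / 2)\<^sup>2) * indicator ?A z \<partial>measure_pmf p)"
    by (simp add: nn_integral_cmult_indicator measure_pmf.emeasure_eq_measure ennreal_mult')
  also have "\<dots> \<le> pmf_var p"
    unfolding pmf_var_def
    by (intro nn_integral_mono) (use sq in \<open>auto split: split_indicator intro!: ennreal_leI\<close>)
  also note var
  finally have "(d / 2)\<^sup>2 * measure_pmf.prob p ?A \<le> v"
    using \<open>v \<ge> 0\<close> by (simp add: ennreal_le_iff)
  then show ?thesis using \<open>d > 0\<close> by (simp add: field_simps)
qed

text \<open>Cut the half-line right of \<open>y\<close> into cells of length \<open>d\<close>.
  Separation leaves at most one point of \<open>F\<close> in each cell, and a point in cell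
  \<open>k\<close> is at distance at least \<open>d * k\<close> from \<open>y\<close>, so the sum is
  dominated by the series of inverse squares scaled by the square of \<open>d\<close>.\<close>

lemma sum_inverse_squares_separated_right:
  fixes F :: "real set"
  assumes "finite F" and "d > 0"
    and sep: "\<And>x z. x \<in> F \<Longrightarrow> z \<in> F \<Longrightarrow> x \<noteq> z \<Longrightarrow> d \<le> \<bar>x - z\<bar>"
    and far: "\<And>x. x \<in> F \<Longrightarrow> y + d \<le> x"
  shows "(\<Sum>x\<in>F. 1 / (x - y)\<^sup>2) \<le> (\<Sum>k. inverse (real k ^ 2)) / d\<^sup>2"
proof -
  \<comment> \<open>\<open>g x\<close> is the index of the cell containing \<open>x\<close>. Points
    of \<open>F\<close> lie at or beyond \<open>y + d\<close>, so the floor is at least 1: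
    \<open>nat\<close> truncates nothing and index 0 never occurs.\<close>
  define g where "g x = nat \<lfloor>(x - y) / d\<rfloor>" for x
  have g: "1 \<le> g x" "real (g x) \<le> (x - y) / d" "(x - y) / d < real (g x) + 1" if "x \<in> F" for x
  proof -
    have "1 \<le> (x - y) / d" using far[OF that] \<open>d > 0\<close> by (simp add: field_simps)
    then have 1: "1 \<le> \<lfloor>(x - y) / d\<rfloor>" by simp
    then have eq: "real (g x) = of_int \<lfloor>(x - y) / d\<rfloor>" by (simp add: g_def)
    show "1 \<le> g x" using 1 unfolding g_def by linarith
    show "real (g x) \<le> (x - y) / d" "(x - y) / d < real (g x) + 1" unfolding eq by linarith+
  qed
  have inj: "inj_on g F"
  proof (rule inj_onI, rule ccontr)
    fix x z assume xz: "x \<in> F" "z \<in> F" "g x = g z" "x \<noteq> z"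
    then have "\<bar>(x - y) / d - (z - y) / d\<bar> < 1"
      using g[of x] g[of z] by auto
    also have "(x - y) / d - (z - y) / d = (x - z) / d" by (simp add: diff_divide_distrib)
    finally have "\<bar>x - z\<bar> < d" using \<open>d > 0\<close> by (simp add: field_simps)
    then show False using sep xz by fastforce
  qed
  have "(\<Sum>x\<in>F. 1 / (x - y)\<^sup>2) \<le> (\<Sum>x\<in>F. inverse (real (g x) ^ 2) / d\<^sup>2)"
  proof (intro sum_mono)
    fix x assume "x \<in> F"
    have "(d * real (g x))\<^sup>2 \<le> (x - y)\<^sup>2"
      using g(2)[OF \<open>x \<in> F\<close>] \<open>d > 0\<close> by (intro power_mono) (auto simp: field_simps)
    then have "1 / (x - y)\<^sup>2 \<le> 1 / (d * real (g x))\<^sup>2"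
      using g(1)[OF \<open>x \<in> F\<close>] far[OF \<open>x \<in> F\<close>] \<open>d > 0\<close>
      by (intro divide_left_mono mult_pos_pos zero_less_power) auto
    then show "1 / (x - y)\<^sup>2 \<le> inverse (real (g x) ^ 2) / d\<^sup>2"
      by (simp add: power_mult_distrib field_simps)
  qed
  also have "\<dots> = (\<Sum>k\<in>g ` F. inverse (real k ^ 2)) / d\<^sup>2"
    by (simp add: sum.reindex[OF inj] sum_divide_distrib)
  \<comment> \<open>The series starts at \<open>k = 0\<close>, where \<open>inverse 0 = 0\<close>
    contributes nothing.\<close>
  also have "\<dots> \<le> (\<Sum>k. inverse (real k ^ 2)) / d\<^sup>2"
    using \<open>finite F\<close> by (intro divide_right_mono sum_le_suminf inverse_power_summable) auto
  finally show ?thesis .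
qed

text \<open>The one-sided bound is applied on each side of \<open>y\<close>, the left side after
  reflection by \<open>uminus\<close>. Requiring separation on \<open>insert y F\<close> keeps all
  of \<open>F\<close> at distance at least \<open>d\<close> from \<open>y\<close>.\<close>

lemma sum_inverse_squares_separated:
  fixes F :: "real set"
  assumes "finite F" and "d > 0" and "y \<notin> F"
    and sep: "\<And>x z. x \<in> insert y F \<Longrightarrow> z \<in> insert y F \<Longrightarrow> x \<noteq> z \<Longrightarrow> d \<le> \<bar>x - z\<bar>"
  shows "(\<Sum>x\<in>F. 1 / (x - y)\<^sup>2) \<le> 2 * (\<Sum>k. inverse (real k ^ 2)) / d\<^sup>2"
proof -
  let ?R = "{x\<in>F. x > y}" and ?L = "{x\<in>F. x < y}"
  have "x > y \<or> x < y" if "x \<in> F" for x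
    using that \<open>y \<notin> F\<close> by (cases x y rule: linorder_cases) auto
  then have "F = ?R \<union> ?L" by blast
  then have "(\<Sum>x\<in>F. 1 / (x - y)\<^sup>2) = (\<Sum>x\<in>?R \<union> ?L. 1 / (x - y)\<^sup>2)" by simp
  also have "\<dots> = (\<Sum>x\<in>?R. 1 / (x - y)\<^sup>2) + (\<Sum>x\<in>?L. 1 / (x - y)\<^sup>2)"
    using \<open>finite F\<close> by (intro sum.union_disjoint) auto
  also have "(\<Sum>x\<in>?L. 1 / (x - y)\<^sup>2) = (\<Sum>x\<in>uminus ` ?L. 1 / (x - - y)\<^sup>2)"
    by (subst sum.reindex) (auto simp: power2_eq_square algebra_simps)
  also have "(\<Sum>x\<in>?R. 1 / (x - y)\<^sup>2) \<le> (\<Sum>k. inverse (real k ^ 2)) / d\<^sup>2"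
  proof (rule sum_inverse_squares_separated_right[OF _ \<open>d > 0\<close>])
    show "y + d \<le> x" if "x \<in> ?R" for x using sep[of x y] that by auto
  qed (use sep \<open>finite F\<close> in auto)
  also have "(\<Sum>x\<in>uminus ` ?L. 1 / (x - - y)\<^sup>2) \<le> (\<Sum>k. inverse (real k ^ 2)) / d\<^sup>2"
  proof (rule sum_inverse_squares_separated_right[OF _ \<open>d > 0\<close>])
    show "- y + d \<le> x" if "x \<in> uminus ` ?L" for x using sep[of "-x" y] that by auto
    show "d \<le> \<bar>x - z\<bar>" if "x \<in> uminus ` ?L" "z \<in> uminus ` ?L" "x \<noteq> z" for x z
      using sep[of "-x" "-z"] that by auto
  qed (use \<open>finite F\<close> in auto)
  finally show ?thesis by simp
qed

section \<open>Column sums of the kernel and its diagonal\<close>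

text \<open>The sum runs over the target \<open>x\<close> with the observation \<open>y\<close>
  fixed, so it is not the total mass of one distribution. The diagonal term is split off; all others
  are controlled by Chebyshev. In \<open>c\<close>, the 8 is the 4 from Chebyshev times the 2 for
  the two sides of \<open>y\<close>.\<close>

lemma column_sum_kernel:
  fixes K :: "real \<Rightarrow> real pmf"
  assumes "d > 0" and "y \<in> T" and "v \<ge> 0"
    and sep: "\<And>x z. x \<in> T \<Longrightarrow> z \<in> T \<Longrightarrow> x \<noteq> z \<Longrightarrow> d \<le> \<bar>x - z\<bar>"
    and var: "\<And>x. x \<in> T \<Longrightarrow> pmf_var (K x) \<le> ennreal v"
    and bias: "\<And>x. x \<in> T \<Longrightarrow> \<bar>measure_pmf.expectation (K x) (\<lambda>z. z) - x\<bar> \<le> d / 2"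
  defines "c \<equiv> 8 * (\<Sum>k. inverse (real k ^ 2)) / d\<^sup>2"
  shows "(\<lambda>x. pmf (K x) y) summable_on T"
    and "\<bar>(\<Sum>\<^sub>\<infinity>x\<in>T. pmf (K x) y) - 1\<bar> \<le> (1 - pmf (K y) y) + c * v"
proof -
  have le: "pmf (K x) y \<le> 4 * v * (1 / (x - y)\<^sup>2)" if "x \<in> T - {y}" for x
  proof -
    have "pmf (K x) y = measure_pmf.prob (K x) {y}" by (simp add: pmf.rep_eq)
    also have "\<dots> \<le> measure_pmf.prob (K x) {z. \<bar>x - y\<bar> \<le> \<bar>z - x\<bar>}"
      by (intro measure_pmf.finite_measure_mono) auto
    \<comment> \<open>The radius is taken as large as possible, \<bar>x - y\<bar> instead of
      \<open>d\<close>, to obtain quadratic decay in \<open>x\<close>. The bias condition carries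
      over since \<open>d\<close> is at most this radius.\<close>
    also have "\<dots> \<le> 4 * v / \<bar>x - y\<bar>\<^sup>2"
      using that bias[of x] sep[of x y] var[of x] \<open>y \<in> T\<close>
      by (intro pmf_chebyshev \<open>v \<ge> 0\<close>) auto
    finally show ?thesis by simp
  qed
  have fin: "(\<Sum>x\<in>F. pmf (K x) y) \<le> c * v" if F: "finite F" "F \<subseteq> T - {y}" for F
  proof -
    have "(\<Sum>x\<in>F. pmf (K x) y) \<le> (\<Sum>x\<in>F. 4 * v * (1 / (x - y)\<^sup>2))"
      using le F by (intro sum_mono) auto
    also have "\<dots> = 4 * v * (\<Sum>x\<in>F. 1 / (x - y)\<^sup>2)" by (simp only: sum_distrib_left)
    also have "\<dots> \<le> 4 * v * (2 * (\<Sum>k. inverse (real k ^ 2)) / d\<^sup>2)"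
      using F \<open>d > 0\<close> \<open>v \<ge> 0\<close> \<open>y \<in> T\<close> sep
      by (intro mult_left_mono sum_inverse_squares_separated) auto
    finally show ?thesis by (simp add: c_def mult_ac)
  qed
  have summ: "(\<lambda>x. pmf (K x) y) summable_on (T - {y})"
    using fin by (intro nonneg_bdd_above_summable_on bdd_aboveI2[where M = "c * v"]) auto
  have T: "T = insert y (T - {y})" using \<open>y \<in> T\<close> by auto
  have "(\<lambda>x. pmf (K x) y) summable_on insert y (T - {y})"
    using summ by (simp only: summable_on_insert_iff)
  then show "(\<lambda>x. pmf (K x) y) summable_on T" by (simp only: T[symmetric])
  have eq: "(\<Sum>\<^sub>\<infinity>x\<in>T. pmf (K x) y) = pmf (K y) y + (\<Sum>\<^sub>\<infinity>x\<in>T - {y}. pmf (K x) y)"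
    using infsum_insert[OF summ, of y] by (simp only: T[symmetric]) simp
  have "(\<Sum>\<^sub>\<infinity>x\<in>T - {y}. pmf (K x) y) \<le> c * v"
    using summ fin by (rule infsum_le_finite_sums)
  moreover have "0 \<le> (\<Sum>\<^sub>\<infinity>x\<in>T - {y}. pmf (K x) y)" by (intro infsum_nonneg) auto
  moreover have "pmf (K y) y \<le> 1" by (rule pmf_le_1)
  ultimately show "\<bar>(\<Sum>\<^sub>\<infinity>x\<in>T. pmf (K x) y) - 1\<bar> \<le> (1 - pmf (K y) y) + c * v"
    unfolding eq by linarith
qed

text \<open>Since \<open>y\<close> is isolated in \<open>S\<close>, all mass not at \<open>y\<close>
  sits at distance at least some \<open>e\<close> from it, and Chebyshev with this fixed radius
  makes that mass vanish. The rate depends on \<open>e\<close>, hence on the point.\<close>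

lemma pmf_diagonal_tendsto_1:
  fixes p :: "nat \<Rightarrow> real pmf"
  assumes "topological_space_class.discrete S" and "y \<in> S"
    and supp: "\<forall>\<^sub>F n in sequentially. set_pmf (p n) \<subseteq> S"
    and bias: "\<And>e. e > 0 \<Longrightarrow> \<forall>\<^sub>F n in sequentially. \<bar>measure_pmf.expectation (p n) (\<lambda>z. z) - y\<bar> \<le> e"
    and var: "\<forall>\<^sub>F n in sequentially. pmf_var (p n) \<le> ennreal (v n)" and "v \<longlonglongrightarrow> 0" and "\<And>n. v n \<ge> 0"
  shows "(\<lambda>n. pmf (p n) y) \<longlonglongrightarrow> 1"
proof -
  obtain e where e: "e > 0" "\<And>z. z \<in> S \<Longrightarrow> dist y z < e \<Longrightarrow> z = y"
    using discreteD[OF assms(1,2)] by (auto simp: isolated_in_dist_Ex_iff)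
  have lower: "\<forall>\<^sub>F n in sequentially. 1 - 4 * v n / e\<^sup>2 \<le> pmf (p n) y"
    using supp bias[OF half_gt_zero[OF e(1)]] var
  proof eventually_elim
    case (elim n)
    have "1 - pmf (p n) y = measure_pmf.prob (p n) (- {y})"
      using measure_pmf.prob_compl[of "{y}" "p n"] by (simp add: pmf.rep_eq Compl_eq_Diff_UNIV)
    \<comment> \<open>The inclusion of events holds only within \<open>S\<close>, hence almost
      everywhere.\<close>
    also have "\<dots> \<le> measure_pmf.prob (p n) {z. e \<le> \<bar>z - y\<bar>}"
      using elim(1) e(2)
      by (intro measure_pmf.finite_measure_mono_AE) (fastforce simp: AE_measure_pmf_iff dist_real_def abs_minus_commute not_less[symmetric])+
    also have "\<dots> \<le> 4 * v n / e\<^sup>2"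
      using elim assms(7) e(1) by (intro pmf_chebyshev) auto
    finally show ?case by simp
  qed
  have "(\<lambda>n. 1 - 4 * v n / e\<^sup>2) \<longlonglongrightarrow> 1 - 4 * 0 / e\<^sup>2"
    using e(1) by (intro tendsto_intros \<open>v \<longlonglongrightarrow> 0\<close>) auto
  then have lim: "(\<lambda>n. 1 - 4 * v n / e\<^sup>2) \<longlonglongrightarrow> 1" by simp
  have "\<forall>\<^sub>F n in sequentially. pmf (p n) y \<le> 1" by (simp add: pmf_le_1)
  from tendsto_sandwich[OF lower this lim tendsto_const] show ?thesis .
qed

section \<open>From the sample to the distribution \<open>f\<close>, and averaging\<close>

text \<open>The law of \<open>X\<close> is known only through its point masses. These already add up
  to 1 over the countable support, so nothing is left outside it and integrals of
  \<open>g (X \<omega>)\<close> become sums over the support.\<close>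

lemma
  fixes X :: "'a \<Rightarrow> real" and g :: "real \<Rightarrow> ennreal"
  assumes "prob_space M" and [measurable]: "X \<in> borel_measurable M"
    and X: "\<And>x. measure M {\<omega> \<in> space M. X \<omega> = x} = pmf f x"
  shows AE_in_set_pmf: "AE \<omega> in M. X \<omega> \<in> set_pmf f"
    and nn_integral_pmf_distr: "(\<integral>\<^sup>+\<omega>. g (X \<omega>) \<partial>M) = (\<integral>\<^sup>+x. g x \<partial>measure_pmf f)"
proof -
  interpret prob_space M by fact
  \<comment> \<open>The indicator allows splitting by the value of \<open>X\<close> before it is
    known that \<open>X\<close> stays in the support. Taking \<open>g = 1\<close> then yields that
    fact, which in turn removes the indicator.\<close>
  have main: "(\<integral>\<^sup>+\<omega>. g (X \<omega>) * indicator (set_pmf f) (X \<omega>) \<partial>M) = (\<integral>\<^sup>+x. g x \<partial>measure_pmf f)" for g :: "real \<Rightarrow> ennreal"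
  proof -
    have "(\<integral>\<^sup>+\<omega>. g (X \<omega>) * indicator (set_pmf f) (X \<omega>) \<partial>M)
        = (\<integral>\<^sup>+\<omega>. \<integral>\<^sup>+x. g x * indicator {\<omega> \<in> space M. X \<omega> = x} \<omega> \<partial>count_space (set_pmf f) \<partial>M)"
    proof (rule nn_integral_cong)
      fix \<omega> assume \<omega>: "\<omega> \<in> space M"
      show "g (X \<omega>) * indicator (set_pmf f) (X \<omega>)
        = (\<integral>\<^sup>+x. g x * indicator {\<omega> \<in> space M. X \<omega> = x} \<omega> \<partial>count_space (set_pmf f))"
      proof (cases "X \<omega> \<in> set_pmf f")
        case True
        then show ?thesis
          using \<omega> by (subst nn_integral_count_space'[of "{X \<omega>}"]) auto
      next
        case False
        then show ?thesis
          by (subst nn_integral_count_space'[of "{}"]) (auto split: split_indicator)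
      qed
    qed
    also have "\<dots> = (\<integral>\<^sup>+x. \<integral>\<^sup>+\<omega>. g x * indicator {\<omega> \<in> space M. X \<omega> = x} \<omega> \<partial>M \<partial>count_space (set_pmf f))"
      by (rule nn_integral_count_space_nn_integral) auto
    also have "\<dots> = (\<integral>\<^sup>+x. ennreal (pmf f x) * g x \<partial>count_space (set_pmf f))"
      by (simp add: nn_integral_cmult_indicator emeasure_eq_measure X mult.commute)
    also have "\<dots> = (\<integral>\<^sup>+x. g x \<partial>measure_pmf f)"
      unfolding nn_integral_measure_pmf
      by (intro nn_integral_count_space_eq) (auto simp: set_pmf_iff)
    finally show ?thesis .
  qed
  have [measurable]: "set_pmf f \<in> sets borel"
    by (rule sets.countable) auto
  have "emeasure M {\<omega> \<in> space M. X \<omega> \<in> set_pmf f} = (\<integral>\<^sup>+\<omega>. indicator {\<omega> \<in> space M. X \<omega> \<in> set_pmf f} \<omega> \<partial>M)"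
    by simp
  also have "\<dots> = (\<integral>\<^sup>+\<omega>. 1 * indicator (set_pmf f) (X \<omega>) \<partial>M)"
    by (intro nn_integral_cong) (auto split: split_indicator)
  also have "\<dots> = 1" by (subst main) (simp add: measure_pmf.emeasure_space_1)
  finally have "prob {\<omega> \<in> space M. X \<omega> \<in> set_pmf f} = 1"
    by (simp add: emeasure_eq_measure)
  then show AE: "AE \<omega> in M. X \<omega> \<in> set_pmf f"
    using AE_prob_1 by fastforce
  show "(\<integral>\<^sup>+\<omega>. g (X \<omega>) \<partial>M) = (\<integral>\<^sup>+x. g x \<partial>measure_pmf f)"
    unfolding main[symmetric] by (intro nn_integral_cong_AE) (use AE in auto)
qed

lemma has_sum_sum:
  fixes f :: "'i \<Rightarrow> 'b \<Rightarrow> 'c::topological_comm_monoid_add"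
  assumes "\<And>i. i \<in> I \<Longrightarrow> (f i has_sum s i) A"
  shows "((\<lambda>x. \<Sum>i\<in>I. f i x) has_sum (\<Sum>i\<in>I. s i)) A"
  using assms by (induction I rule: infinite_finite_induct) (auto intro: has_sum_add)

text \<open>Summability at each observation allows the outer series and the finite sum to be
  interchanged, so the default value 0 of a divergent series does not interfere. The rest is
  Jensen's inequality for an average of \<open>n\<close> numbers.\<close>

lemma normalizer_minus_1_squared_le:
  assumes "n \<ge> 1"
    and summ: "\<And>i. i \<in> {1..n} \<Longrightarrow> (\<lambda>x. pmf (K x (h n)) (X i \<omega>)) summable_on T"
  shows "(normalizer T K h X n \<omega> - 1)\<^sup>2
    \<le> 1 / real n * (\<Sum>i=1..n. ((\<Sum>\<^sub>\<infinity>x\<in>T. pmf (K x (h n)) (X i \<omega>)) - 1)\<^sup>2)"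
proof -
  let ?G = "\<lambda>i. (\<Sum>\<^sub>\<infinity>x\<in>T. pmf (K x (h n)) (X i \<omega>))"
  have "((\<lambda>x. \<Sum>i=1..n. pmf (K x (h n)) (X i \<omega>)) has_sum (\<Sum>i=1..n. ?G i)) T"
    using summ by (intro has_sum_sum has_sum_infsum) auto
  then have "normalizer T K h X n \<omega> = 1 / real n * (\<Sum>i=1..n. ?G i)"
    unfolding normalizer_def by (intro infsumI has_sum_cmult_right)
  then have "normalizer T K h X n \<omega> - 1 = 1 / real n * (\<Sum>i=1..n. ?G i - 1)"
    using \<open>n \<ge> 1\<close> by (simp add: sum_subtractf field_simps)
  then have "(normalizer T K h X n \<omega> - 1)\<^sup>2 = (1 / real n)\<^sup>2 * (\<Sum>i=1..n. ?G i - 1)\<^sup>2"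
    by (simp only: power_mult_distrib)
  also have "\<dots> \<le> (1 / real n)\<^sup>2 * ((\<Sum>i=1..n. (?G i - 1)\<^sup>2) * real (card {1..n}))"
    by (intro mult_left_mono sum_squared_le_sum_of_squares) auto
  also have "\<dots> = 1 / real n * (\<Sum>i=1..n. (?G i - 1)\<^sup>2)"
    using \<open>n \<ge> 1\<close> by (simp add: power2_eq_square)
  finally show ?thesis .
qed

section \<open>Mean square convergence of the normalizer\<close>

theorem proposition2p1:
  fixes M :: "'a measure" and f :: "real pmf" and T :: "real set"
    and X :: "nat \<Rightarrow> 'a \<Rightarrow> real" and h :: "nat \<Rightarrow> real"
    and S :: "real \<Rightarrow> real set" and K :: "real \<Rightarrow> real \<Rightarrow> real pmf"
  assumes "prob_space M"
    and "T = set_pmf f" and "uniform_discrete T"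
    and "prob_space.indep_vars M (\<lambda>_. borel) X {1..}"
    and "\<And>i x. i \<ge> 1 \<Longrightarrow> measure M {\<omega> \<in> space M. X i \<omega> = x} = pmf f x"
    and "\<And>n. n \<ge> 1 \<Longrightarrow> h n > 0" and "h \<longlonglongrightarrow> 0"
    and "\<And>x. x \<in> T \<Longrightarrow> topological_space_class.discrete (S x)"
    and "\<And>x b. x \<in> T \<Longrightarrow> b > 0 \<Longrightarrow> set_pmf (K x b) \<subseteq> S x"
    and "\<And>n. n \<ge> 1 \<Longrightarrow> AE \<omega> in M. normalizer T K h X n \<omega> > 0"
    and "\<And>x. x \<in> T \<Longrightarrow> x \<in> S x"
    and "(\<lambda>n. SUP x\<in>T. ennreal \<bar>measure_pmf.expectation (K x (h n)) (\<lambda>z. z) - x\<bar>) \<longlonglongrightarrow> 0"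
    and "(\<lambda>n. SUP x\<in>T. pmf_var (K x (h n))) \<longlonglongrightarrow> 0"
  shows "(\<lambda>n. \<integral>\<^sup>+ \<omega>. ennreal (\<bar>normalizer T K h X n \<omega> - 1\<bar>\<^sup>2) \<partial>M) \<longlonglongrightarrow> 0"
proof -
  interpret prob_space M by fact
  note T = assms(2)
  obtain d where "d > 0" and sep: "\<And>x z. x \<in> T \<Longrightarrow> z \<in> T \<Longrightarrow> x \<noteq> z \<Longrightarrow> d \<le> \<bar>x - z\<bar>"
    using assms(3) unfolding uniform_discrete_def dist_real_def by (meson not_le)
  define c where "c = 8 * (\<Sum>k. inverse (real k ^ 2)) / d\<^sup>2"
  define v where "v n = enn2real (SUP x\<in>T. pmf_var (K x (h n)))" for n
  have v_lim: "v \<longlonglongrightarrow> 0"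
    using tendsto_enn2real[of _ 0, simplified, OF assms(13)] by (simp add: v_def[abs_def])
  have v_nonneg: "v n \<ge> 0" for n by (simp add: v_def)
  \<comment> \<open>\<open>enn2real\<close> sends \<infinity> to 0, so \<open>v n\<close> bounds the
    variances only once their supremum is finite, which holds eventually.\<close>
  have var: "\<forall>\<^sub>F n in sequentially. \<forall>x\<in>T. pmf_var (K x (h n)) \<le> ennreal (v n)"
    using order_tendstoD(2)[OF assms(13), of \<top>, simplified]
  proof eventually_elim
    case (elim n)
    then have "ennreal (v n) = (SUP x\<in>T. pmf_var (K x (h n)))"
      unfolding v_def by (intro ennreal_enn2real)
    then show ?case by (auto intro: SUP_upper)
  qed
  have bias: "\<forall>\<^sub>F n in sequentially. \<forall>x\<in>T. \<bar>measure_pmf.expectation (K x (h n)) (\<lambda>z. z) - x\<bar> \<le> e"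
    if "e > 0" for e
    using order_tendstoD(2)[OF assms(12), of "ennreal e", simplified, OF that]
  proof eventually_elim
    case (elim n)
    show ?case
    proof
      fix x assume "x \<in> T"
      then have "ennreal \<bar>measure_pmf.expectation (K x (h n)) (\<lambda>z. z) - x\<bar> < ennreal e"
        using elim by (meson SUP_upper le_less_trans)
      then show "\<bar>measure_pmf.expectation (K x (h n)) (\<lambda>z. z) - x\<bar> \<le> e"
        by (simp add: ennreal_less_iff)
    qed
  qed
  \<comment> \<open>Cut off outside the countable set \<open>T\<close> to make \<open>b n (X i \<omega>)\<close> measurable in \<open>\<omega>\<close>.\<close>
  define b where "b n y = (if y \<in> T then 2 * (1 - pmf (K y (h n)) y) + 2 * (c * v n)\<^sup>2 else 0)" for n y
  have b_meas[measurable]: "b n \<in> borel_measurable borel" for n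
    by (rule measurable_discrete_difference[of "\<lambda>_. 0" _ _ T]) (auto simp: b_def T)
  have b_nonneg: "0 \<le> b n y" for n y by (simp add: b_def pmf_le_1)
  have b_int: "integrable (measure_pmf f) (b n)" for n
    by (rule measure_pmf.integrable_const_bound[where B = "2 + 2 * (c * v n)\<^sup>2"])
       (auto simp: b_def pmf_le_1)
  have bound: "\<forall>\<^sub>F n in sequentially.
    (\<integral>\<^sup>+\<omega>. ennreal (\<bar>normalizer T K h X n \<omega> - 1\<bar>\<^sup>2) \<partial>M) \<le> ennreal (\<integral>y. b n y \<partial>measure_pmf f)"
    using eventually_ge_at_top[of 1] var bias[OF half_gt_zero[OF \<open>d > 0\<close>]]
  proof eventually_elim
    case (elim n)
    note col = column_sum_kernel[where K = "\<lambda>x. K x (h n)" and v = "v n",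
        OF \<open>d > 0\<close> _ v_nonneg sep elim(2,3)[rule_format], folded c_def]
    have X_meas[measurable]: "X i \<in> borel_measurable M" if "i \<ge> 1" for i
      using assms(4) that by (simp add: indep_vars_def)
    have sq: "((\<Sum>\<^sub>\<infinity>x\<in>T. pmf (K x (h n)) y) - 1)\<^sup>2 \<le> b n y" if "y \<in> T" for y
    proof -
      let ?a = "1 - pmf (K y (h n)) y"
      have a: "0 \<le> ?a" "?a \<le> 1" by (auto simp: pmf_le_1)
      have "((\<Sum>\<^sub>\<infinity>x\<in>T. pmf (K x (h n)) y) - 1)\<^sup>2 = \<bar>(\<Sum>\<^sub>\<infinity>x\<in>T. pmf (K x (h n)) y) - 1\<bar>\<^sup>2" by simp
      also have "\<dots> \<le> (?a + c * v n)\<^sup>2"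
        by (intro power_mono col that) auto
      \<comment> \<open>The cross term is absorbed by the two squares. Replacing the square of
        \<open>?a\<close> by \<open>?a\<close> afterwards makes the bound linear in the diagonal
        defect and gives exactly \<open>b n y\<close>.\<close>
      also have "\<dots> \<le> 2 * ?a\<^sup>2 + 2 * (c * v n)\<^sup>2"
        unfolding power2_sum using sum_squares_bound[of ?a "c * v n"] by linarith
      also have "?a\<^sup>2 \<le> ?a" using a by (simp add: power2_eq_square mult_left_le)
      finally show ?thesis by (simp add: b_def that)
    qed
    have AE: "AE \<omega> in M. \<forall>i\<in>{1..n}. X i \<omega> \<in> T"
      unfolding T by (intro AE_finite_allI AE_in_set_pmf) (use assms(1,5) X_meas in auto)
    have "(\<integral>\<^sup>+\<omega>. ennreal (\<bar>normalizer T K h X n \<omega> - 1\<bar>\<^sup>2) \<partial>M)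
        \<le> (\<integral>\<^sup>+\<omega>. ennreal (1 / real n) * (\<Sum>i=1..n. ennreal (b n (X i \<omega>))) \<partial>M)"
      using AE
    proof (intro nn_integral_mono_AE, eventually_elim)
      fix \<omega> assume X: "\<forall>i\<in>{1..n}. X i \<omega> \<in> T"
      have "\<bar>normalizer T K h X n \<omega> - 1\<bar>\<^sup>2
          \<le> 1 / real n * (\<Sum>i=1..n. ((\<Sum>\<^sub>\<infinity>x\<in>T. pmf (K x (h n)) (X i \<omega>)) - 1)\<^sup>2)"
        unfolding power2_abs
        by (intro normalizer_minus_1_squared_le elim(1) col(1)) (use X in auto)
      also have "\<dots> \<le> 1 / real n * (\<Sum>i=1..n. b n (X i \<omega>))"
        using X by (intro mult_left_mono sum_mono sq) auto
      finally have "ennreal (\<bar>normalizer T K h X n \<omega> - 1\<bar>\<^sup>2) \<le> ennreal (1 / real n * (\<Sum>i=1..n. b n (X i \<omega>)))"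
        by (rule ennreal_leI)
      also have "\<dots> = ennreal (1 / real n) * (\<Sum>i=1..n. ennreal (b n (X i \<omega>)))"
        by (subst ennreal_mult) (auto simp: b_nonneg sum_nonneg sum_ennreal)
      finally show "ennreal (\<bar>normalizer T K h X n \<omega> - 1\<bar>\<^sup>2)
        \<le> ennreal (1 / real n) * (\<Sum>i=1..n. ennreal (b n (X i \<omega>)))" .
    qed
    also have "\<dots> = ennreal (1 / real n) * (\<Sum>i=1..n. \<integral>\<^sup>+\<omega>. ennreal (b n (X i \<omega>)) \<partial>M)"
      by (subst nn_integral_cmult, measurable) (auto intro!: arg_cong2[where f=times] nn_integral_sum)
    \<comment> \<open>All \<open>X i\<close> have law \<open>f\<close>, so the summands coincide and
      the average collapses to a single integral of \<open>b n\<close>.\<close>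
    also have "(\<Sum>i=1..n. \<integral>\<^sup>+\<omega>. ennreal (b n (X i \<omega>)) \<partial>M) = (\<Sum>i=1..n. \<integral>\<^sup>+y. ennreal (b n y) \<partial>measure_pmf f)"
      by (intro sum.cong refl nn_integral_pmf_distr assms(1,5) X_meas) auto
    also have "(\<integral>\<^sup>+y. ennreal (b n y) \<partial>measure_pmf f) = ennreal (\<integral>y. b n y \<partial>measure_pmf f)"
      using b_nonneg b_int by (intro nn_integral_eq_integral) auto
    also have "ennreal (1 / real n) * (\<Sum>i=1..n. ennreal (\<integral>y. b n y \<partial>measure_pmf f)) = ennreal (\<integral>y. b n y \<partial>measure_pmf f)"
      using elim(1) by (simp add: ennreal_of_nat_eq_real_of_nat b_nonneg flip: mult.assoc ennreal_mult)
    finally show ?case .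
  qed
  have "(\<lambda>n. \<integral>y. b n y \<partial>measure_pmf f) \<longlonglongrightarrow> 0"
  proof -
    \<comment> \<open>Dominated convergence replaces uniformity in \<open>y\<close>: the isolation
      radius of \<open>y\<close> in \<open>S y\<close> may shrink along \<open>T\<close>, so the
      diagonal defect is only known to vanish pointwise.\<close>
    have "(\<lambda>n. \<integral>y. 1 - pmf (K y (h n)) y \<partial>measure_pmf f) \<longlonglongrightarrow> (\<integral>y. 0 \<partial>measure_pmf f)"
    proof (rule integral_dominated_convergence[where w = "\<lambda>_. 1"])
      show "AE y in measure_pmf f. (\<lambda>n. 1 - pmf (K y (h n)) y) \<longlonglongrightarrow> 0"
        unfolding AE_measure_pmf_iff T[symmetric]
      proof
        fix y assume y: "y \<in> T"
        have "(\<lambda>n. pmf (K y (h n)) y) \<longlonglongrightarrow> 1"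
        proof (rule pmf_diagonal_tendsto_1[OF assms(8)[OF y] assms(11)[OF y] _ _ _ v_lim v_nonneg])
          \<comment> \<open>The index 0 is skipped because \<open>h n\<close> is known to be
            positive only from \<open>n = 1\<close> on.\<close>
          show "\<forall>\<^sub>F n in sequentially. set_pmf (K y (h n)) \<subseteq> S y"
            using eventually_ge_at_top[of 1] by eventually_elim (use assms(6,9) y in blast)
          show "\<forall>\<^sub>F n in sequentially. \<bar>measure_pmf.expectation (K y (h n)) (\<lambda>z. z) - y\<bar> \<le> e"
            if "e > 0" for e
            using bias[OF that] by eventually_elim (use y in blast)
          show "\<forall>\<^sub>F n in sequentially. pmf_var (K y (h n)) \<le> ennreal (v n)"
            using var by eventually_elim (use y in blast)
        qed
        from tendsto_diff[OF tendsto_const this, of 1]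
        show "(\<lambda>n. 1 - pmf (K y (h n)) y) \<longlonglongrightarrow> 0" by simp
      qed
    qed (auto simp: pmf_le_1)
    then have "(\<lambda>n. 2 * (\<integral>y. 1 - pmf (K y (h n)) y \<partial>measure_pmf f) + 2 * (c * v n)\<^sup>2) \<longlonglongrightarrow> 2 * 0 + 2 * (c * 0)\<^sup>2"
      by (intro tendsto_intros v_lim) simp
    moreover have "(\<integral>y. b n y \<partial>measure_pmf f)
        = 2 * (\<integral>y. 1 - pmf (K y (h n)) y \<partial>measure_pmf f) + 2 * (c * v n)\<^sup>2" for n
    proof -
      have int: "integrable (measure_pmf f) (\<lambda>y. 1 - pmf (K y (h n)) y)"
        by (rule measure_pmf.integrable_const_bound[where B = 1]) (auto simp: pmf_le_1)
      \<comment> \<open>\<open>f\<close> is concentrated on \<open>T\<close>, so the cutoff in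
        \<open>b\<close> does not affect the integral.\<close>
      have "(\<integral>y. b n y \<partial>measure_pmf f) = (\<integral>y. 2 * (1 - pmf (K y (h n)) y) + 2 * (c * v n)\<^sup>2 \<partial>measure_pmf f)"
        by (intro integral_cong_AE) (auto simp: AE_measure_pmf_iff b_def T)
      also have "\<dots> = 2 * (\<integral>y. 1 - pmf (K y (h n)) y \<partial>measure_pmf f) + 2 * (c * v n)\<^sup>2"
        by (subst Bochner_Integration.integral_add) (use int in \<open>auto simp del: right_diff_distrib_numeral\<close>)
      finally show ?thesis .
    qed
    ultimately show ?thesis by simp
  qed
  then have "(\<lambda>n. ennreal (\<integral>y. b n y \<partial>measure_pmf f)) \<longlonglongrightarrow> 0"
    using tendsto_ennrealI by fastforce
  then show ?thesis
    by (intro tendsto_sandwich[OF _ bound tendsto_const]) auto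
qed

end
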